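(* Let $S$ be a semiring, $T$ a multiplicatively closed subset of $S$, and let $I$ be a $k$-primary ideal of $S$ with $\mathcal{R}_k(I)=P$. Then: (1) $IS_T$ is a $k$-primary ideal of $S_T$. (2) If $P\cap T=\emptyset$, then $IS_T\cap S=I$. (3) If $P\cap T=\emptyset$, then $(IS_T:_{S_T}PS_T)=(I:_SP)S_T$. (4) If $P\cap T=\emptyset$ and $J$ is a $k$-ideal of $S$ such that $JS_T\subseteq IS_T$, then $J\subseteq I$.
   Context: A semiring is a commutative semiring $(S,+,0,\cdot,1)$ with multiplicative identity $1$ and additive identity $0$ that is absorbing. An ideal is a nonempty subset closed under addition and under multiplication by elements of $S$. A $k$-ideal is an ideal $I$ such that $x+y\in I$ and $y\in I$ imply $x\in I$. A $k$-ideal $I$ is $k$-prime if for all $k$-ideals $A,B$, $AB\subseteq I$ implies $A\subseteq I$ or $B\subseteq I$, where $AB$ is the ideal of finite sums of products $ab$ with $a\in A$, $b\in B$. A $k$-ideal $I$ is $k$-primary if $ab\in I$ and $a\notin I$ imply $b^n\in I$ for some natural number $n\ge 1$. The $k$-radical $\mathcal{R}_k(I)$ is the intersection of all $k$-prime ideals of $S$ containing $I$. A multiplicatively closed subset $T$ contains $1$ and is closed under products. $S_T=T^{-1}S$ is the usual semiring of fractions $x/s$ ($x\in S$, $s\in T$), with $x/s=y/t$ iff $uxt=uys$ for some $u\in T$. For an ideal $J$ of $S$, $JS_T=T^{-1}J=\{x/s: x\in J,s\in T\}$; for an ideal $L$ of $S_T$, $L\cap S$ means $\{x\in S: x/1\in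 L\}$. $(A:_RB)=\{r\in R: rB\subseteq A\}$. *)

theory Defs
  imports "HOL-Algebra.Ideal_Product"
begin

text \<open>Commutative semirings with \<open>\<zero>\<close> absorbing; \<open>\<zero> = \<one>\<close> is allowed, so that fractions
  with respect to a \<open>T\<close> containing \<open>\<zero>\<close> are covered.\<close>

locale csemiring = semiring R + comm_monoid R for R (structure)

definition semiring_ideal :: "('a, 'm) ring_scheme \<Rightarrow> 'a set \<Rightarrow> bool" where
  "semiring_ideal R I \<longleftrightarrow> I \<subseteq> carrier R \<and> I \<noteq> {} \<and>
     (\<forall>x\<in>I. \<forall>y\<in>I. x \<oplus>\<^bsub>R\<^esub> y \<in> I) \<and>
     (\<forall>r\<in>carrier R. \<forall>x\<in>I. r \<otimes>\<^bsub>R\<^esub> x \<in> I)"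

definition k_ideal :: "('a, 'm) ring_scheme \<Rightarrow> 'a set \<Rightarrow> bool" where
  "k_ideal R I \<longleftrightarrow> semiring_ideal R I \<and>
     (\<forall>x\<in>carrier R. \<forall>y\<in>carrier R. x \<oplus>\<^bsub>R\<^esub> y \<in> I \<longrightarrow> y \<in> I \<longrightarrow> x \<in> I)"

text \<open>Neither \<open>k\<close>-prime nor \<open>k\<close>-primary ideals are required to be proper. The product
  \<open>ideal_prod R A B\<close> is the closure of the products \<open>a \<otimes> b\<close> under addition, that is, the set
  of their nonempty finite sums; the empty sum adds nothing, as \<open>\<zero> = \<zero> \<otimes> \<zero>\<close> and every
  \<open>k\<close>-ideal contains \<open>\<zero>\<close>.\<close>

definition k_prime :: "('a, 'm) ring_scheme \<Rightarrow> 'a set \<Rightarrow> bool" where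
  "k_prime R I \<longleftrightarrow> k_ideal R I \<and>
     (\<forall>A B. k_ideal R A \<longrightarrow> k_ideal R B \<longrightarrow> ideal_prod R A B \<subseteq> I \<longrightarrow> A \<subseteq> I \<or> B \<subseteq> I)"

definition k_primary :: "('a, 'm) ring_scheme \<Rightarrow> 'a set \<Rightarrow> bool" where
  "k_primary R I \<longleftrightarrow> k_ideal R I \<and>
     (\<forall>a\<in>carrier R. \<forall>b\<in>carrier R. a \<otimes>\<^bsub>R\<^esub> b \<in> I \<longrightarrow> a \<notin> I \<longrightarrow>
        (\<exists>n::nat. n \<ge> 1 \<and> b [^]\<^bsub>R\<^esub> n \<in> I))"

text \<open>The intersection is taken inside \<open>carrier R\<close>, so an empty family gives \<open>carrier R\<close>.\<close>

definition k_radical :: "('a, 'm) ring_scheme \<Rightarrow> 'a set \<Rightarrow> 'a set" where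
  "k_radical R I = carrier R \<inter> \<Inter>{Q. k_prime R Q \<and> I \<subseteq> Q}"

definition ideal_colon :: "('a, 'm) ring_scheme \<Rightarrow> 'a set \<Rightarrow> 'a set \<Rightarrow> 'a set" where
  "ideal_colon R A B = {r \<in> carrier R. \<forall>b\<in>B. r \<otimes>\<^bsub>R\<^esub> b \<in> A}"

definition frac_rel :: "('a, 'm) ring_scheme \<Rightarrow> 'a set \<Rightarrow> (('a \<times> 'a) \<times> ('a \<times> 'a)) set" where
  "frac_rel S T = {((x, s), (y, t)). x \<in> carrier S \<and> s \<in> T \<and> y \<in> carrier S \<and> t \<in> T \<and>
     (\<exists>u\<in>T. u \<otimes>\<^bsub>S\<^esub> x \<otimes>\<^bsub>S\<^esub> t = u \<otimes>\<^bsub>S\<^esub> y \<otimes>\<^bsub>S\<^esub> s)}"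

definition frac :: "('a, 'm) ring_scheme \<Rightarrow> 'a set \<Rightarrow> 'a \<Rightarrow> 'a \<Rightarrow> ('a \<times> 'a) set" where
  "frac S T x s = frac_rel S T `` {(x, s)}"

text \<open>The operations on classes are given by unions over representatives; \<open>frac_mult\<close> and
  \<open>frac_add\<close> below show that these are the usual operations on fractions.\<close>

definition localization :: "('a, 'm) ring_scheme \<Rightarrow> 'a set \<Rightarrow> ('a \<times> 'a) set ring" where
  "localization S T =
     \<lparr>carrier = (carrier S \<times> T) // frac_rel S T,
      mult = (\<lambda>X Y. \<Union>(x, s)\<in>X. \<Union>(y, t)\<in>Y. frac S T (x \<otimes>\<^bsub>S\<^esub> y) (s \<otimes>\<^bsub>S\<^esub> t)),
      one = frac S T \<one>\<^bsub>S\<^esub> \<one>\<^bsub>S\<^esub>,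
      zero = frac S T \<zero>\<^bsub>S\<^esub> \<one>\<^bsub>S\<^esub>,
      add = (\<lambda>X Y. \<Union>(x, s)\<in>X. \<Union>(y, t)\<in>Y.
               frac S T (x \<otimes>\<^bsub>S\<^esub> t \<oplus>\<^bsub>S\<^esub> y \<otimes>\<^bsub>S\<^esub> s) (s \<otimes>\<^bsub>S\<^esub> t))\<rparr>"

definition extension :: "('a, 'm) ring_scheme \<Rightarrow> 'a set \<Rightarrow> 'a set \<Rightarrow> ('a \<times> 'a) set set" where
  "extension S T J = {frac S T x s | x s. x \<in> J \<and> s \<in> T}"

definition contraction :: "('a, 'm) ring_scheme \<Rightarrow> 'a set \<Rightarrow> ('a \<times> 'a) set set \<Rightarrow> 'a set" where
  "contraction S T L = {x \<in> carrier S. frac S T x \<one>\<^bsub>S\<^esub> \<in> L}"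

locale csemiring_fractions = csemiring S + submonoid T S for S (structure) and T
begin

lemma T_carrier: "t \<in> T \<Longrightarrow> t \<in> carrier S"
  using subset by blast

lemma frac_relI:
  assumes "x \<in> carrier S" "s \<in> T" "y \<in> carrier S" "t \<in> T" "u \<in> T"
    and "u \<otimes> x \<otimes> t = u \<otimes> y \<otimes> s"
  shows "((x, s), (y, t)) \<in> frac_rel S T"
  using assms by (auto simp: frac_rel_def)

lemma equiv_frac_rel: "equiv (carrier S \<times> T) (frac_rel S T)"
proof (rule equivI)
  show "frac_rel S T \<subseteq> (carrier S \<times> T) \<times> carrier S \<times> T"
    by (auto simp: frac_rel_def)
  show "refl_on (carrier S \<times> T) (frac_rel S T)"
    by (auto simp: refl_on_def frac_rel_def)
  show "sym (frac_rel S T)"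
    by (auto simp: sym_def frac_rel_def) (metis+)
  show "trans (frac_rel S T)"
  proof (rule transI, clarify)
    fix x s y t z w
    assume a: "((x, s), (y, t)) \<in> frac_rel S T" and b: "((y, t), (z, w)) \<in> frac_rel S T"
    then obtain u v where u: "u \<in> T" "u \<otimes> x \<otimes> t = u \<otimes> y \<otimes> s"
      and v: "v \<in> T" "v \<otimes> y \<otimes> w = v \<otimes> z \<otimes> t"
      and c: "x \<in> carrier S" "y \<in> carrier S" "z \<in> carrier S" "s \<in> T" "t \<in> T" "w \<in> T"
      by (auto simp: frac_rel_def)
    note cc = c c(4-6)[THEN T_carrier] u(1)[THEN T_carrier] v(1)[THEN T_carrier]
    have "(u \<otimes> v \<otimes> t) \<otimes> x \<otimes> w = (u \<otimes> x \<otimes> t) \<otimes> (v \<otimes> w)"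
      using cc by (simp add: m_ac)
    also have "\<dots> = (v \<otimes> y \<otimes> w) \<otimes> (u \<otimes> s)"
      using cc u(2) by (simp add: m_ac)
    also have "\<dots> = (u \<otimes> v \<otimes> t) \<otimes> z \<otimes> s"
      unfolding v(2) using cc by (simp add: m_ac)
    finally show "((x, s), (z, w)) \<in> frac_rel S T"
      using c u v by (intro frac_relI[where u = "u \<otimes> v \<otimes> t"]) auto
  qed
qed

lemma frac_eq_iff:
  assumes "x \<in> carrier S" "s \<in> T" "y \<in> carrier S" "t \<in> T"
  shows "frac S T x s = frac S T y t \<longleftrightarrow> (\<exists>u\<in>T. u \<otimes> x \<otimes> t = u \<otimes> y \<otimes> s)"
  using eq_equiv_class_iff[OF equiv_frac_rel, of "(x, s)" "(y, t)"] assms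
  by (auto simp: frac_def frac_rel_def)

lemma frac_closed:
  "x \<in> carrier S \<Longrightarrow> s \<in> T \<Longrightarrow> frac S T x s \<in> carrier (localization S T)"
  by (auto simp: localization_def frac_def intro: quotientI)

lemma fracE:
  assumes "X \<in> carrier (localization S T)"
  obtains x s where "x \<in> carrier S" "s \<in> T" "X = frac S T x s"
  using assms by (auto simp: localization_def frac_def elim!: quotientE)

lemma congruent2_mult:
  "(\<lambda>(x, s) (y, t). frac S T (x \<otimes> y) (s \<otimes> t)) respects2 frac_rel S T"
proof (rule congruent2_commuteI[OF equiv_frac_rel], clarify)
  fix x s y t assume "x \<in> carrier S" "s \<in> T" "y \<in> carrier S" "t \<in> T"
  then show "frac S T (x \<otimes> y) (s \<otimes> t) = frac S T (y \<otimes> x) (t \<otimes> s)"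
    by (simp add: m_comm T_carrier)
next
  fix p q r assume "(p, q) \<in> frac_rel S T" "r \<in> carrier S \<times> T"
  moreover obtain x s y t z w where e: "p = (x, s)" "q = (y, t)" "r = (z, w)"
    by (metis surj_pair)
  ultimately obtain u where u: "u \<in> T" "u \<otimes> x \<otimes> t = u \<otimes> y \<otimes> s"
    and c: "x \<in> carrier S" "y \<in> carrier S" "z \<in> carrier S" "s \<in> T" "t \<in> T" "w \<in> T"
    by (auto simp: frac_rel_def)
  note cc = c c(4-6)[THEN T_carrier] u(1)[THEN T_carrier]
  have "u \<otimes> (z \<otimes> x) \<otimes> (w \<otimes> t) = (u \<otimes> x \<otimes> t) \<otimes> (z \<otimes> w)"
    using cc by (simp add: m_ac)
  also have "\<dots> = u \<otimes> (z \<otimes> y) \<otimes> (w \<otimes> s)"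
    unfolding u(2) using cc by (simp add: m_ac)
  finally show "(case r of (x, s) \<Rightarrow> \<lambda>(y, t). frac S T (x \<otimes> y) (s \<otimes> t)) p =
      (case r of (x, s) \<Rightarrow> \<lambda>(y, t). frac S T (x \<otimes> y) (s \<otimes> t)) q"
    using cc u e by (auto simp: frac_eq_iff)
qed

lemma congruent2_add:
  "(\<lambda>(x, s) (y, t). frac S T (x \<otimes> t \<oplus> y \<otimes> s) (s \<otimes> t)) respects2 frac_rel S T"
proof (rule congruent2_commuteI[OF equiv_frac_rel], clarify)
  fix x s y t assume "x \<in> carrier S" "s \<in> T" "y \<in> carrier S" "t \<in> T"
  then show "frac S T (x \<otimes> t \<oplus> y \<otimes> s) (s \<otimes> t) = frac S T (y \<otimes> s \<oplus> x \<otimes> t) (t \<otimes> s)"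
    by (simp add: m_comm a_comm T_carrier)
next
  fix p q r assume "(p, q) \<in> frac_rel S T" "r \<in> carrier S \<times> T"
  moreover obtain x s y t z w where e: "p = (x, s)" "q = (y, t)" "r = (z, w)"
    by (metis surj_pair)
  ultimately obtain u where u: "u \<in> T" "u \<otimes> x \<otimes> t = u \<otimes> y \<otimes> s"
    and c: "x \<in> carrier S" "y \<in> carrier S" "z \<in> carrier S" "s \<in> T" "t \<in> T" "w \<in> T"
    by (auto simp: frac_rel_def)
  note cc = c c(4-6)[THEN T_carrier] u(1)[THEN T_carrier]
  have "u \<otimes> (z \<otimes> s \<oplus> x \<otimes> w) \<otimes> (w \<otimes> t) = u \<otimes> z \<otimes> s \<otimes> w \<otimes> t \<oplus> (u \<otimes> x \<otimes> t) \<otimes> (w \<otimes> w)"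
    using cc by (simp add: m_ac l_distr r_distr)
  also have "\<dots> = u \<otimes> (z \<otimes> t \<oplus> y \<otimes> w) \<otimes> (w \<otimes> s)"
    unfolding u(2) using cc by (simp add: m_ac l_distr r_distr)
  finally show "(case r of (x, s) \<Rightarrow> \<lambda>(y, t). frac S T (x \<otimes> t \<oplus> y \<otimes> s) (s \<otimes> t)) p =
      (case r of (x, s) \<Rightarrow> \<lambda>(y, t). frac S T (x \<otimes> t \<oplus> y \<otimes> s) (s \<otimes> t)) q"
    using cc u e by (auto simp: frac_eq_iff)
qed

lemma frac_mult:
  assumes "x \<in> carrier S" "s \<in> T" "y \<in> carrier S" "t \<in> T"
  shows "frac S T x s \<otimes>\<^bsub>localization S T\<^esub> frac S T y t = frac S T (x \<otimes> y) (s \<otimes> t)"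
  using UN_equiv_class2[OF equiv_frac_rel equiv_frac_rel congruent2_mult,
      of "(x, s)" "(y, t)"] assms
  by (simp add: localization_def frac_def split_def)

lemma frac_add:
  assumes "x \<in> carrier S" "s \<in> T" "y \<in> carrier S" "t \<in> T"
  shows "frac S T x s \<oplus>\<^bsub>localization S T\<^esub> frac S T y t = frac S T (x \<otimes> t \<oplus> y \<otimes> s) (s \<otimes> t)"
  using UN_equiv_class2[OF equiv_frac_rel equiv_frac_rel congruent2_add,
      of "(x, s)" "(y, t)"] assms
  by (simp add: localization_def frac_def split_def)

lemma localization_one: "\<one>\<^bsub>localization S T\<^esub> = frac S T \<one> \<one>"
  by (simp add: localization_def)

lemma localization_zero: "\<zero>\<^bsub>localization S T\<^esub> = frac S T \<zero> \<one>"
  by (simp add: localization_def)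

theorem csemiring_localization: "csemiring (localization S T)"
proof -
  note simps = frac_mult frac_add localization_one localization_zero frac_closed T_carrier
    m_ac a_ac l_distr r_distr
  have add: "abelian_monoid (localization S T)"
    by (rule abelian_monoidI; (elim fracE)?)
       (simp_all add: simps)
  have mult: "comm_monoid (localization S T)"
    by (rule comm_monoidI; (elim fracE)?) (simp_all add: simps)
  have distr: "(X \<oplus>\<^bsub>localization S T\<^esub> Y) \<otimes>\<^bsub>localization S T\<^esub> Z =
      X \<otimes>\<^bsub>localization S T\<^esub> Z \<oplus>\<^bsub>localization S T\<^esub> Y \<otimes>\<^bsub>localization S T\<^esub> Z"
    if "X \<in> carrier (localization S T)" "Y \<in> carrier (localization S T)"
      "Z \<in> carrier (localization S T)" for X Y Z
    using that
    by (elim fracE) (auto simp: simps frac_eq_iff intro!: bexI[of _ \<one>])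
  have null: "\<zero>\<^bsub>localization S T\<^esub> \<otimes>\<^bsub>localization S T\<^esub> X = \<zero>\<^bsub>localization S T\<^esub>"
    if "X \<in> carrier (localization S T)" for X
    using that
    by (elim fracE) (auto simp: simps frac_eq_iff intro!: bexI[of _ \<one>])
  interpret L: comm_monoid "localization S T" by (fact mult)
  interpret A: abelian_monoid "localization S T" by (fact add)
  show ?thesis
    by unfold_locales (use distr null L.m_comm A.zero_closed A.a_closed in \<open>metis\<close>)+
qed

end

end

theory Submission
  imports Defs
begin

text \<open>If some power of \<open>b\<close> lies in \<open>I\<close>, then \<open>b\<close> lies in every \<open>k\<close>-prime over \<open>I\<close>, hence in
  \<open>P\<close>. So if \<open>P\<close> misses \<open>T\<close>, then \<open>u \<otimes> x \<in> I\<close> with \<open>u \<in> T\<close> forces \<open>x \<in> I\<close>, as \<open>I\<close> is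
  \<open>k\<close>-primary. Everything then follows from the criterion that \<open>x / s \<in> I S\<^sub>T\<close> iff
  \<open>u \<otimes> x \<in> I\<close> for some \<open>u \<in> T\<close>.\<close>

section \<open>Ideals and \<open>k\<close>-ideals\<close>

lemma semiring_idealD:
  assumes "semiring_ideal R I"
  shows "I \<subseteq> carrier R" "I \<noteq> {}"
    "\<And>x y. x \<in> I \<Longrightarrow> y \<in> I \<Longrightarrow> x \<oplus>\<^bsub>R\<^esub> y \<in> I"
    "\<And>r x. r \<in> carrier R \<Longrightarrow> x \<in> I \<Longrightarrow> r \<otimes>\<^bsub>R\<^esub> x \<in> I"
  using assms by (auto simp: semiring_ideal_def)

lemma k_ideal_semiring_ideal: "k_ideal R I \<Longrightarrow> semiring_ideal R I"
  by (simp add: k_ideal_def)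

lemma k_ideal_cancel:
  assumes "k_ideal R I" "x \<in> carrier R" "x \<oplus>\<^bsub>R\<^esub> y \<in> I" "y \<in> I"
  shows "x \<in> I"
  using assms semiring_idealD(1)[OF k_ideal_semiring_ideal] by (fastforce simp: k_ideal_def)

lemma k_primary_k_ideal: "k_primary R I \<Longrightarrow> k_ideal R I"
  by (simp add: k_primary_def)

lemma k_prime_k_ideal: "k_prime R I \<Longrightarrow> k_ideal R I"
  by (simp add: k_prime_def)

text \<open>For \<open>a\<close> in the carrier of a commutative semiring this is the least
  \<open>k\<close>-ideal containing \<open>a\<close>. Without subtraction,
  \<open>x = (s - r) \<otimes> a\<close> has to be written with both terms on the positive
  side.\<close>

definition principal_k_ideal :: "('a, 'm) ring_scheme \<Rightarrow> 'a \<Rightarrow> 'a set" where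
  "principal_k_ideal R a = {x \<in> carrier R. \<exists>r\<in>carrier R. \<exists>s\<in>carrier R.
     x \<oplus>\<^bsub>R\<^esub> r \<otimes>\<^bsub>R\<^esub> a = s \<otimes>\<^bsub>R\<^esub> a}"

section \<open>Principal \<open>k\<close>-ideals, \<open>k\<close>-primes and the
  \<open>k\<close>-radical\<close>

context csemiring
begin

lemma principal_k_idealI:
  assumes "x \<in> carrier R" "r \<in> carrier R" "s \<in> carrier R" "x \<oplus> r \<otimes> a = s \<otimes> a"
  shows "x \<in> principal_k_ideal R a"
  using assms by (auto simp: principal_k_ideal_def)

lemma principal_k_idealE:
  assumes "x \<in> principal_k_ideal R a"
  obtains r s where "x \<in> carrier R" "r \<in> carrier R" "s \<in> carrier R" "x \<oplus> r \<otimes> a = s \<otimes> a"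
  using assms by (auto simp: principal_k_ideal_def)

lemma mem_principal_k_ideal: "a \<in> carrier R \<Longrightarrow> a \<in> principal_k_ideal R a"
  by (rule principal_k_idealI[where r = \<zero> and s = \<one>]) auto

lemma k_ideal_principal:
  assumes a: "a \<in> carrier R"
  shows "k_ideal R (principal_k_ideal R a)"
  unfolding k_ideal_def semiring_ideal_def
proof (intro conjI ballI impI)
  show "principal_k_ideal R a \<subseteq> carrier R"
    by (auto simp: principal_k_ideal_def)
  show "principal_k_ideal R a \<noteq> {}"
    using mem_principal_k_ideal[OF a] by blast
next
  fix x y assume "x \<in> principal_k_ideal R a" "y \<in> principal_k_ideal R a"
  then obtain r s t u where c: "x \<in> carrier R" "y \<in> carrier R"
      "r \<in> carrier R" "s \<in> carrier R" "t \<in> carrier R" "u \<in> carrier R"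
    and e: "x \<oplus> r \<otimes> a = s \<otimes> a" "y \<oplus> t \<otimes> a = u \<otimes> a"
    by (elim principal_k_idealE)
  have "x \<oplus> y \<oplus> (r \<oplus> t) \<otimes> a = (x \<oplus> r \<otimes> a) \<oplus> (y \<oplus> t \<otimes> a)"
    using c a by (simp add: l_distr a_ac)
  also have "\<dots> = (s \<oplus> u) \<otimes> a"
    unfolding e using c a by (simp add: l_distr)
  finally show "x \<oplus> y \<in> principal_k_ideal R a"
    using c by (intro principal_k_idealI[where r = "r \<oplus> t" and s = "s \<oplus> u"]) auto
next
  fix q x assume q: "q \<in> carrier R" and "x \<in> principal_k_ideal R a"
  then obtain r s where c: "x \<in> carrier R" "r \<in> carrier R" "s \<in> carrier R"
    and e: "x \<oplus> r \<otimes> a = s \<otimes> a"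
    by (elim principal_k_idealE)
  have "q \<otimes> x \<oplus> (q \<otimes> r) \<otimes> a = q \<otimes> (x \<oplus> r \<otimes> a)"
    using c q a by (simp add: r_distr m_assoc)
  also have "\<dots> = (q \<otimes> s) \<otimes> a"
    unfolding e using c q a by (simp add: m_assoc)
  finally show "q \<otimes> x \<in> principal_k_ideal R a"
    using c q by (intro principal_k_idealI[where r = "q \<otimes> r" and s = "q \<otimes> s"]) auto
next
  fix x y assume "x \<in> carrier R"
    and "x \<oplus> y \<in> principal_k_ideal R a" "y \<in> principal_k_ideal R a"
  then obtain r s t u where c: "x \<in> carrier R" "y \<in> carrier R"
      "r \<in> carrier R" "s \<in> carrier R" "t \<in> carrier R" "u \<in> carrier R"
    and e: "x \<oplus> y \<oplus> r \<otimes> a = s \<otimes> a" "y \<oplus> t \<otimes> a = u \<otimes> a"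
    by (elim principal_k_idealE)
  \<comment> \<open>Since \<open>u \<otimes> a\<close> equals
    \<open>y \<oplus> t \<otimes> a\<close>, adding it to \<open>x\<close> brings in the missing
    \<open>y\<close>, and the equation for \<open>x \<oplus> y\<close> then applies.\<close>
  have "x \<oplus> (u \<oplus> r) \<otimes> a = x \<oplus> u \<otimes> a \<oplus> r \<otimes> a"
    using c a by (simp add: l_distr a_ac)
  also have "\<dots> = (x \<oplus> y \<oplus> r \<otimes> a) \<oplus> t \<otimes> a"
    unfolding e(2)[symmetric] using c a by (simp add: a_ac)
  also have "\<dots> = (s \<oplus> t) \<otimes> a"
    unfolding e(1) using c a by (simp add: l_distr)
  finally show "x \<in> principal_k_ideal R a"
    using c by (intro principal_k_idealI[where r = "u \<oplus> r" and s = "s \<oplus> t"]) auto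
qed

text \<open>Multiplying the equation that defines membership of \<open>x\<close> by \<open>q\<close>
  puts the sum and its second summand into \<open>Q\<close>, so the first summand can be cancelled
  out. In other words, the elements that \<open>q\<close> multiplies into \<open>Q\<close> form a
  \<open>k\<close>-ideal, which contains all of \<open>principal_k_ideal R a\<close> once it
  contains \<open>a\<close>.\<close>

lemma principal_k_ideal_mult_mem:
  assumes Q: "k_ideal R Q" and "a \<in> carrier R" "x \<in> principal_k_ideal R a"
    and q: "q \<in> carrier R" "q \<otimes> a \<in> Q"
  shows "q \<otimes> x \<in> Q"
proof -
  obtain r s where c: "x \<in> carrier R" "r \<in> carrier R" "s \<in> carrier R"
    and e: "x \<oplus> r \<otimes> a = s \<otimes> a"
    using assms(3) by (elim principal_k_idealE)
  have "q \<otimes> x \<oplus> r \<otimes> (q \<otimes> a) = q \<otimes> (x \<oplus> r \<otimes> a)"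
    using c q assms(2) by (simp add: r_distr m_lcomm)
  also have "\<dots> = s \<otimes> (q \<otimes> a)"
    unfolding e using c q assms(2) by (simp add: m_lcomm)
  finally have "q \<otimes> x \<oplus> r \<otimes> (q \<otimes> a) \<in> Q"
    using semiring_idealD(4)[OF k_ideal_semiring_ideal[OF Q]] c q by simp
  moreover have "r \<otimes> (q \<otimes> a) \<in> Q"
    using semiring_idealD(4)[OF k_ideal_semiring_ideal[OF Q]] c q by simp
  ultimately show ?thesis
    using k_ideal_cancel[OF Q] c q by simp
qed

text \<open>This passes from the ideal form of primeness to the elementwise one: the definition is
  applied to the \<open>k\<close>-ideals generated by \<open>a\<close> and \<open>b\<close>.\<close>

lemma k_prime_multD:
  assumes Q: "k_prime R Q" and a: "a \<in> carrier R" and b: "b \<in> carrier R" and "a \<otimes> b \<in> Q"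
  shows "a \<in> Q \<or> b \<in> Q"
proof -
  note kQ = k_prime_k_ideal[OF Q]
  have mult: "x \<otimes> y \<in> Q" if x: "x \<in> principal_k_ideal R a" and y: "y \<in> principal_k_ideal R b"
    for x y
  proof -
    have xc: "x \<in> carrier R" using x by (rule principal_k_idealE)
    \<comment> \<open>One factor moves at a time: first \<open>a\<close> becomes \<open>x\<close>
      with \<open>b\<close> fixed, then \<open>b\<close> becomes \<open>y\<close> with
      \<open>x\<close> fixed.\<close>
    have "b \<otimes> x \<in> Q"
      using principal_k_ideal_mult_mem[OF kQ a x b] assms(4) a b by (simp add: m_comm)
    then show ?thesis
      using principal_k_ideal_mult_mem[OF kQ b y xc] xc b by (simp add: m_comm)
  qed
  \<comment> \<open>\<open>ideal_prod\<close> is generated inductively by products and sums, so the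
    claim on products and closure of \<open>Q\<close> under addition suffice.\<close>
  have "x \<in> Q" if "x \<in> ideal_prod R (principal_k_ideal R a) (principal_k_ideal R b)" for x
    using that
    by induction (simp_all add: mult semiring_idealD(3)[OF k_ideal_semiring_ideal[OF kQ]])
  then have "principal_k_ideal R a \<subseteq> Q \<or> principal_k_ideal R b \<subseteq> Q"
    using Q k_ideal_principal[OF a] k_ideal_principal[OF b] unfolding k_prime_def by blast
  then show ?thesis
    using mem_principal_k_ideal a b by blast
qed

lemma k_prime_powD:
  assumes Q: "k_prime R Q" and b: "b \<in> carrier R" and "n \<ge> 1" "b [^] (n::nat) \<in> Q"
  shows "b \<in> Q"
  using assms(3,4)
proof (induction n rule: dec_induct)
  case base
  then show ?case using b by simp
next
  case (step n)
  then show ?case using k_prime_multD[OF Q _ b, of "b [^] n"] b by auto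
qed

lemma k_radical_powI:
  assumes "b \<in> carrier R" "n \<ge> 1" "b [^] (n::nat) \<in> I"
  shows "b \<in> k_radical R I"
  using assms k_prime_powD by (auto simp: k_radical_def)

lemma k_primary_cancel:
  assumes I: "k_primary R I" and "u \<in> carrier R" "u \<notin> k_radical R I"
    and "x \<in> carrier R" "u \<otimes> x \<in> I"
  shows "x \<in> I"
proof (rule ccontr)
  assume "x \<notin> I"
  \<comment> \<open>The factors are swapped because \<open>k_primary\<close> yields a power of the
    second factor, and \<open>u\<close> is the one to be pushed into the radical.\<close>
  moreover have "x \<otimes> u \<in> I" using assms by (simp add: m_comm)
  ultimately obtain n :: nat where "n \<ge> 1" "u [^] n \<in> I"
    using I assms(2,4) unfolding k_primary_def by blast
  then show False using k_radical_powI assms(2,3) by blast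
qed

end

section \<open>Extension of ideals to the semiring of fractions\<close>

context csemiring_fractions
begin

lemma frac_mem_extensionI: "x \<in> J \<Longrightarrow> s \<in> T \<Longrightarrow> frac S T x s \<in> extension S T J"
  by (auto simp: extension_def)

text \<open>Membership in the extension provides some representative with numerator in
  \<open>I\<close>, while the given numerator \<open>x\<close> may lie outside \<open>I\<close>. The
  factor \<open>u\<close> makes up for the change of representative.\<close>

lemma frac_mem_extension_iff:
  assumes I: "semiring_ideal S I" and x: "x \<in> carrier S" and s: "s \<in> T"
  shows "frac S T x s \<in> extension S T I \<longleftrightarrow> (\<exists>u\<in>T. u \<otimes> x \<in> I)"
proof
  assume "frac S T x s \<in> extension S T I"
  then obtain i t where i: "i \<in> I" and t: "t \<in> T" and e: "frac S T x s = frac S T i t"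
    by (auto simp: extension_def)
  have ic: "i \<in> carrier S" using i semiring_idealD(1)[OF I] by blast
  obtain u where u: "u \<in> T" "u \<otimes> x \<otimes> t = u \<otimes> i \<otimes> s"
    using e frac_eq_iff[OF x s ic t] by blast
  note c = x ic s[THEN T_carrier] t[THEN T_carrier] u(1)[THEN T_carrier]
  \<comment> \<open>The equality of fractions, regrouped, makes \<open>u \<otimes> t\<close> a
    multiplier from \<open>T\<close> that sends \<open>x\<close> to a multiple of
    \<open>i\<close>.\<close>
  have "(u \<otimes> t) \<otimes> x = (u \<otimes> s) \<otimes> i" using u(2) c by (simp add: m_ac)
  also have "\<dots> \<in> I" using semiring_idealD(4)[OF I] i c by simp
  finally show "\<exists>u\<in>T. u \<otimes> x \<in> I" using u(1) t by blast
next
  assume "\<exists>u\<in>T. u \<otimes> x \<in> I"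
  then obtain u where u: "u \<in> T" "u \<otimes> x \<in> I" by blast
  note c = x s[THEN T_carrier] u(1)[THEN T_carrier]
  \<comment> \<open>Expanding the fraction by \<open>u\<close> gives a representative whose
    numerator is in \<open>I\<close>.\<close>
  have "frac S T x s = frac S T (u \<otimes> x) (u \<otimes> s)"
    using c s u by (subst frac_eq_iff) (auto intro!: bexI[of _ \<one>] simp: m_ac)
  then show "frac S T x s \<in> extension S T I"
    using u s by (auto simp: extension_def)
qed

lemma extension_subset: "J \<subseteq> carrier S \<Longrightarrow> extension S T J \<subseteq> carrier (localization S T)"
  using frac_closed by (auto simp: extension_def)

text \<open>The second conjunct is carried through the induction because \<open>frac_mult\<close>
  asks for denominators in \<open>T\<close>.\<close>

lemma frac_pow:
  assumes "x \<in> carrier S" "s \<in> T"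
  shows "frac S T x s [^]\<^bsub>localization S T\<^esub> (n::nat) = frac S T (x [^] n) (s [^] n)
    \<and> s [^] n \<in> T"
  using assms by (induction n) (auto simp: localization_one frac_mult)

lemma k_ideal_extension:
  assumes I: "k_ideal S I"
  shows "k_ideal (localization S T) (extension S T I)"
  unfolding k_ideal_def semiring_ideal_def
proof (intro conjI ballI impI)
  note sI = k_ideal_semiring_ideal[OF I]
  have IC: "i \<in> carrier S" if "i \<in> I" for i using semiring_idealD(1)[OF sI] that by blast
  note mem = frac_mem_extension_iff[OF sI]
  show "extension S T I \<subseteq> carrier (localization S T)"
    using extension_subset semiring_idealD(1)[OF sI] .
  show "extension S T I \<noteq> {}"
    using semiring_idealD(2)[OF sI] frac_mem_extensionI one_closed by blast
  {
    fix X Y assume "X \<in> extension S T I" "Y \<in> extension S T I"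
    then obtain i s j t where ij: "i \<in> I" "j \<in> I" and st: "s \<in> T" "t \<in> T"
      and e: "X = frac S T i s" "Y = frac S T j t"
      by (auto simp: extension_def)
    have "t \<otimes> i \<oplus> s \<otimes> j \<in> I"
      using semiring_idealD(3,4)[OF sI] ij st T_carrier by blast
    then have "i \<otimes> t \<oplus> j \<otimes> s \<in> I"
      using ij st IC T_carrier by (simp add: m_comm)
    then show "X \<oplus>\<^bsub>localization S T\<^esub> Y \<in> extension S T I"
      using ij st IC by (auto simp: e frac_add extension_def)
  next
    fix X Y assume "X \<in> carrier (localization S T)" "Y \<in> extension S T I"
    then obtain x s j t where x: "x \<in> carrier S" and j: "j \<in> I" and st: "s \<in> T" "t \<in> T"
      and e: "X = frac S T x s" "Y = frac S T j t"
      by (elim fracE) (auto simp: extension_def)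
    then show "X \<otimes>\<^bsub>localization S T\<^esub> Y \<in> extension S T I"
      using semiring_idealD(4)[OF sI x j] IC by (auto simp: frac_mult extension_def)
  next
    fix X Y assume "X \<in> carrier (localization S T)"
      and XY: "X \<oplus>\<^bsub>localization S T\<^esub> Y \<in> extension S T I" and "Y \<in> extension S T I"
    then obtain x s j t where x: "x \<in> carrier S" and j: "j \<in> I" and st: "s \<in> T" "t \<in> T"
      and e: "X = frac S T x s" "Y = frac S T j t"
      by (elim fracE) (auto simp: extension_def)
    note c = x j[THEN IC] st[THEN T_carrier]
    have "frac S T (x \<otimes> t \<oplus> j \<otimes> s) (s \<otimes> t) \<in> extension S T I"
      using XY c st by (simp add: e frac_add)
    then obtain u where u: "u \<in> T" "u \<otimes> (x \<otimes> t \<oplus> j \<otimes> s) \<in> I"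
      using mem[of "x \<otimes> t \<oplus> j \<otimes> s" "s \<otimes> t"] c st by auto
    note uc = u(1)[THEN T_carrier]
    \<comment> \<open>The second summand is a multiple of \<open>j\<close>, hence in
      \<open>I\<close>; cancelling it in \<open>I\<close> leaves \<open>u \<otimes> t\<close> as the
      multiplier for \<open>x\<close>.\<close>
    have "u \<otimes> (x \<otimes> t \<oplus> j \<otimes> s) = (u \<otimes> t) \<otimes> x \<oplus> (u \<otimes> s) \<otimes> j"
      using c uc by (simp add: r_distr m_ac)
    moreover have "(u \<otimes> s) \<otimes> j \<in> I"
      using semiring_idealD(4)[OF sI] c uc j by simp
    ultimately have "(u \<otimes> t) \<otimes> x \<in> I"
      using k_ideal_cancel[OF I] u(2) c uc by simp
    then show "X \<in> extension S T I"
      unfolding e using mem[OF x st(1)] u(1) st(2) by blast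
  }
qed

lemma k_primary_extension:
  assumes I: "k_primary S I"
  shows "k_primary (localization S T) (extension S T I)"
  unfolding k_primary_def
proof (intro conjI ballI impI)
  note kI = k_primary_k_ideal[OF I]
  note mem = frac_mem_extension_iff[OF k_ideal_semiring_ideal[OF kI]]
  show "k_ideal (localization S T) (extension S T I)"
    using kI by (rule k_ideal_extension)
  fix X Y assume "X \<in> carrier (localization S T)" "Y \<in> carrier (localization S T)"
    and XY: "X \<otimes>\<^bsub>localization S T\<^esub> Y \<in> extension S T I" and X: "X \<notin> extension S T I"
  then obtain x s y t where xy: "x \<in> carrier S" "y \<in> carrier S" and st: "s \<in> T" "t \<in> T"
    and e: "X = frac S T x s" "Y = frac S T y t"
    by (elim fracE)
  have "frac S T (x \<otimes> y) (s \<otimes> t) \<in> extension S T I"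
    using XY xy st by (simp add: e frac_mult)
  then obtain u where u: "u \<in> T" "u \<otimes> (x \<otimes> y) \<in> I"
    using mem[of "x \<otimes> y" "s \<otimes> t"] xy st by auto
  note uc = u(1)[THEN T_carrier]
  \<comment> \<open>The factor \<open>u\<close> is grouped with \<open>x\<close>: as
    \<open>X\<close> is outside the extension, no multiple of \<open>x\<close> by an element of
    \<open>T\<close> is in \<open>I\<close>, so a power of \<open>y\<close> itself must be.
    \<open>u\<close> is kept and not cancelled, since \<open>T\<close> may meet the radical
    here.\<close>
  have "(u \<otimes> x) \<otimes> y \<in> I" using u uc xy by (simp add: m_assoc)
  moreover have "u \<otimes> x \<in> carrier S" using uc xy by simp
  moreover have "u \<otimes> x \<notin> I" using X mem[OF xy(1) st(1)] u(1) e by blast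
  ultimately obtain n :: nat where n: "n \<ge> 1" "y [^] n \<in> I"
    using I xy unfolding k_primary_def by blast
  then have "Y [^]\<^bsub>localization S T\<^esub> n \<in> extension S T I"
    using frac_pow[OF xy(2) st(2), of n] by (auto simp: e extension_def)
  then show "\<exists>n\<ge>1. Y [^]\<^bsub>localization S T\<^esub> (n::nat) \<in> extension S T I"
    using n(1) by blast
qed

text \<open>When \<open>T\<close> misses the radical, \<open>k_primary_cancel\<close> removes the
  factor \<open>u\<close>, so every representative shows membership by its numerator. For the
  converse, \<open>s\<close> itself can serve as \<open>u\<close>.\<close>

lemma frac_mem_extension_k_primary_iff:
  assumes I: "k_primary S I" and T: "k_radical S I \<inter> T = {}" and x: "x \<in> carrier S" and s: "s \<in> T"
  shows "frac S T x s \<in> extension S T I \<longleftrightarrow> x \<in> I"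
proof -
  have sI: "semiring_ideal S I"
    using I by (simp add: k_primary_k_ideal k_ideal_semiring_ideal)
  show ?thesis
    using frac_mem_extension_iff[OF sI x s] k_primary_cancel[OF I _ _ x] T T_carrier s
      semiring_idealD(4)[OF sI]
    by blast
qed

lemma contraction_extension_k_primary:
  assumes I: "k_primary S I" and T: "k_radical S I \<inter> T = {}"
  shows "contraction S T (extension S T I) = I"
proof -
  have "I \<subseteq> carrier S"
    using I by (simp add: k_primary_k_ideal k_ideal_semiring_ideal semiring_idealD(1))
  then show ?thesis
    using frac_mem_extension_k_primary_iff[OF I T _ one_closed] by (auto simp: contraction_def)
qed

text \<open>For a general ideal the multiplier \<open>u\<close> would depend on \<open>p\<close>,
  and the first inclusion usually calls for a finiteness condition on \<open>P\<close>. Here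
  \<open>u\<close> is cancelled, so the numerator \<open>r\<close> of a single representative works
  for all \<open>p\<close> at once.\<close>

lemma ideal_colon_extension_k_primary:
  assumes I: "k_primary S I" and T: "k_radical S I \<inter> T = {}" and P: "P \<subseteq> carrier S"
  shows "ideal_colon (localization S T) (extension S T I) (extension S T P) =
    extension S T (ideal_colon S I P)"
proof (intro equalityI subsetI)
  note mem = frac_mem_extension_k_primary_iff[OF I T]
  fix X assume X: "X \<in> ideal_colon (localization S T) (extension S T I) (extension S T P)"
  then obtain r s where r: "r \<in> carrier S" and s: "s \<in> T" and e: "X = frac S T r s"
    unfolding ideal_colon_def by (blast elim: fracE)
  \<comment> \<open>Testing \<open>X\<close> on the fractions \<open>p / 1\<close> is enough: the
    product has numerator \<open>r \<otimes> p\<close>.\<close>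
  have "r \<otimes> p \<in> I" if p: "p \<in> P" for p
  proof -
    have "frac S T p \<one> \<in> extension S T P" using p by (simp add: frac_mem_extensionI)
    then have "X \<otimes>\<^bsub>localization S T\<^esub> frac S T p \<one> \<in> extension S T I"
      using X by (simp add: ideal_colon_def)
    then show ?thesis
      using mem[of "r \<otimes> p" s] r s p P T_carrier by (auto simp: e frac_mult subset_iff)
  qed
  then show "X \<in> extension S T (ideal_colon S I P)"
    using r s by (auto simp: e extension_def ideal_colon_def)
next
  fix X assume "X \<in> extension S T (ideal_colon S I P)"
  then obtain r s where r: "r \<in> carrier S" "\<forall>p\<in>P. r \<otimes> p \<in> I" and s: "s \<in> T"
    and e: "X = frac S T r s"
    by (auto simp: extension_def ideal_colon_def)
  have "X \<otimes>\<^bsub>localization S T\<^esub> Y \<in> extension S T I" if "Y \<in> extension S T P" for Y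
  proof -
    obtain p t where "p \<in> P" "t \<in> T" "Y = frac S T p t"
      using \<open>Y \<in> extension S T P\<close> by (auto simp: extension_def)
    then show ?thesis
      using r s P by (auto simp: e frac_mult frac_mem_extensionI subset_iff)
  qed
  then show "X \<in> ideal_colon (localization S T) (extension S T I) (extension S T P)"
    using r s by (simp add: ideal_colon_def e frac_closed)
qed

end

theorem proposition5p7:
  fixes S :: "('a, 'm) ring_scheme" and T I P :: "'a set"
  assumes "csemiring S"
    and "submonoid T S"
    and "k_primary S I"
    and "k_radical S I = P"
  shows "k_primary (localization S T) (extension S T I) \<and>
     (P \<inter> T = {} \<longrightarrow> contraction S T (extension S T I) = I) \<and>
     (P \<inter> T = {} \<longrightarrow>
        ideal_colon (localization S T) (extension S T I) (extension S T P) =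
          extension S T (ideal_colon S I P)) \<and>
     (P \<inter> T = {} \<longrightarrow>
        (\<forall>J. k_ideal S J \<and> extension S T J \<subseteq> extension S T I \<longrightarrow> J \<subseteq> I))"
proof -
  interpret csemiring_fractions S T
    by (rule csemiring_fractions.intro) fact+
  note I = \<open>k_primary S I\<close>
  have P: "P \<subseteq> carrier S"
    using assms(4) by (auto simp: k_radical_def)
  have "J \<subseteq> I" if "P \<inter> T = {}" "k_ideal S J" "extension S T J \<subseteq> extension S T I" for J
  proof
    fix x assume x: "x \<in> J"
    then have "x \<in> carrier S"
      using semiring_idealD(1)[OF k_ideal_semiring_ideal[OF that(2)]] by blast
    \<comment> \<open>The inclusion of extensions is used only at \<open>x / 1\<close>, whose
      numerator then decides membership of \<open>x\<close> in \<open>I\<close>.\<close>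
    moreover have "frac S T x \<one>\<^bsub>S\<^esub> \<in> extension S T I"
      using frac_mem_extensionI[OF x one_closed] that(3) by blast
    ultimately show "x \<in> I"
      using frac_mem_extension_k_primary_iff[OF I _ _ one_closed] that(1) assms(4) by blast
  qed
  then show ?thesis
    using k_primary_extension[OF I] contraction_extension_k_primary[OF I]
      ideal_colon_extension_k_primary[OF I _ P] assms(4)
    by blast
qed

end
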